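(* Contractive increasing boolean operators are not finitely generated: there is no finite set $G$ of contractive increasing boolean operators (of possibly different arities) such that, for every natural number $n$, every contractive increasing boolean operator $f:\mathbf{B}^n\to\mathbf{B}^n$ is generated by $G$.
   Context: $\mathbf{B}=\{0,1\}$ with $0\le 1$, and $\mathbf{B}^n$ carries the pointwise order. The weight $|u|$ of $u\in\mathbf{B}^n$ is the number of $1$s in $u$. A contractive increasing boolean operator of arity $n$ is a function $f:\mathbf{B}^n\to\mathbf{B}^n$ that is increasing ($u\le v$ implies $f(u)\le f(v)$) and contractive ($|f(u)|\le|u|$ for all $u\in\mathbf{B}^n$). Generation is in the sense of boolean circuits built from cells (i.e. generation as a monoidal category): the set of operators generated by a set $G$ of operators ("cells") is the smallest collection of operators that contains $G$ and all identities $\mathrm{id}:\mathbf{B}^n\to\mathbf{B}^n$ ($n\ge 0$), and is closed under sequential composition ($f,g:\mathbf{B}^n\to\mathbf{B}^n$ gives $g\circ f$) and parallel composition ($f:\mathbf{B}^p\to\mathbf{B}^p$ and $g:\mathbf{B}^q\to\mathbf{B}^q$ give $f\times g:\mathbf{B}^{p+q}\to\mathbf{B}^{p+q}$, acting as $f$ on the first $p$ coordinates and as $g$ on the last $q$ coordinates). The crossing $(b_1,b_2)\mapsto(b_2,b_1)$ is itself a contractive increasing boolean operator and may belong to $G$. *)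

theory Defs
  imports "HOL-Library.FuncSet"
begin

definition bvec :: "nat \<Rightarrow> bool list set" where
  "bvec n = {v. length v = n}"

definition weight :: "bool list \<Rightarrow> nat" where
  "weight v = count_list v True"

definition bvec_le :: "bool list \<Rightarrow> bool list \<Rightarrow> bool" where
  "bvec_le = list_all2 (\<le>)"

text \<open>
  A pair \<open>(n, f)\<close> represents an operator from \<open>bvec n\<close> to \<open>bvec n\<close>. The function is kept
  extensional (\<open>undefined\<close> off \<open>bvec n\<close>), so that equality of pairs is equality of operators.
\<close>

type_synonym bool_op = "nat \<times> (bool list \<Rightarrow> bool list)"

definition bool_ops :: "bool_op set" where
  "bool_ops = (SIGMA n:UNIV. bvec n \<rightarrow>\<^sub>E bvec n)"

definition increasing :: "bool_op \<Rightarrow> bool" where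
  "increasing = (\<lambda>(n, f). \<forall>u\<in>bvec n. \<forall>v\<in>bvec n. bvec_le u v \<longrightarrow> bvec_le (f u) (f v))"

definition contractive :: "bool_op \<Rightarrow> bool" where
  "contractive = (\<lambda>(n, f). \<forall>u\<in>bvec n. weight (f u) \<le> weight u)"

definition contractive_increasing_ops :: "bool_op set" where
  "contractive_increasing_ops = {F \<in> bool_ops. increasing F \<and> contractive F}"

definition id_op :: "nat \<Rightarrow> bool list \<Rightarrow> bool list" where
  "id_op n = (\<lambda>v\<in>bvec n. v)"

definition par_op ::
  "nat \<Rightarrow> nat \<Rightarrow> (bool list \<Rightarrow> bool list) \<Rightarrow> (bool list \<Rightarrow> bool list) \<Rightarrow> bool list \<Rightarrow> bool list"
where
  "par_op p q f g = (\<lambda>v\<in>bvec (p + q). f (take p v) @ g (drop p v))"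

inductive_set generated :: "bool_op set \<Rightarrow> bool_op set" for G :: "bool_op set" where
  cell: "F \<in> G \<Longrightarrow> F \<in> generated G"
| ident: "(n, id_op n) \<in> generated G"
| seq: "(n, f) \<in> generated G \<Longrightarrow> (n, g) \<in> generated G \<Longrightarrow>
    (n, compose (bvec n) g f) \<in> generated G"
| par: "(p, f) \<in> generated G \<Longrightarrow> (q, g) \<in> generated G \<Longrightarrow>
    (p + q, par_op p q f g) \<in> generated G"

end

theory Submission imports Defs begin

text \<open>
  Let the cells have arity at most \<open>m\<close>. Then every generated operator of arity \<open>n\<close> is either
  injective or identifies two distinct vectors of weight at least \<open>n - m\<close>: for parallel
  composition, pad a collision of one factor with ones; for sequential composition after an
  injective, hence bijective, operator \<open>f\<close>, pull a collision back along \<open>f\<close>, which by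
  contractivity does not lower weights. But the operator that kills the vectors of weight
  less than 2 and fixes all others is not injective and has no collision in weight at
  least 2, so it is not generated in arity \<open>m + 2\<close>.
\<close>

lemma bvec_iff [simp]: "v \<in> bvec n \<longleftrightarrow> length v = n"
  by (simp add: bvec_def)

lemma finite_bvec: "finite (bvec n)"
  using finite_lists_length_eq[of "UNIV :: bool set" n] by (simp add: bvec_def)

lemma weight_append [simp]: "weight (u @ v) = weight u + weight v"
  by (simp add: weight_def)

lemma weight_replicate_True [simp]: "weight (replicate n True) = n"
  by (induction n) (simp_all add: weight_def)

lemma weight_replicate_False [simp]: "weight (replicate n False) = 0"
  by (induction n) (simp_all add: weight_def)

lemma weight_mono: "bvec_le u v \<Longrightarrow> weight u \<le> weight v"
  unfolding bvec_le_def by (induction rule: list_all2_induct) (auto simp: weight_def)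

lemma bvec_le_zero: "length v = n \<Longrightarrow> bvec_le (replicate n False) v"
  by (simp add: bvec_le_def list_all2_conv_all_nth)

text \<open>The weight condition says that \<open>x\<close> and \<open>y\<close> contain at most
  \<open>m\<close> zeros each; the additive form avoids truncated subtraction.\<close>

definition heavy_collision :: "nat \<Rightarrow> nat \<Rightarrow> (bool list \<Rightarrow> bool list) \<Rightarrow> bool" where
  "heavy_collision m n f \<longleftrightarrow> (\<exists>x\<in>bvec n. \<exists>y\<in>bvec n. x \<noteq> y \<and> f x = f y \<and>
     n \<le> weight x + m \<and> n \<le> weight y + m)"

text \<open>For arity at most \<open>m\<close> the weight condition is vacuous, so any failure of
  injectivity qualifies.\<close>

lemma heavy_collision_cell:
  assumes "n \<le> m" "\<not> inj_on f (bvec n)"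
  shows "heavy_collision m n f"
  using assms unfolding heavy_collision_def inj_on_def by (meson trans_le_add2)

lemma inj_on_par_op:
  assumes "inj_on f (bvec p)" "inj_on g (bvec q)" "f \<in> bvec p \<rightarrow> bvec p"
  shows "inj_on (par_op p q f g) (bvec (p + q))"
proof (rule inj_onI)
  fix x y
  assume x: "x \<in> bvec (p + q)" and y: "y \<in> bvec (p + q)"
    and eq: "par_op p q f g x = par_op p q f g y"
  \<comment> \<open>Both values of \<open>f\<close> have length \<open>p\<close>, so an equality of
    the concatenated outputs splits at the same position.\<close>
  have len: "length (f (take p x)) = p" "length (f (take p y)) = p"
    using x y assms(3) by (auto simp: Pi_iff)
  have "f (take p x) = f (take p y)" "g (drop p x) = g (drop p y)"
    using eq x y len by (auto simp: par_op_def)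
  then have "take p x = take p y" "drop p x = drop p y"
    using x y by (simp_all add: inj_on_eq_iff[OF assms(1)] inj_on_eq_iff[OF assms(2)])
  then show "x = y"
    by (metis append_take_drop_id)
qed

text \<open>Padding with \<open>q\<close> ones raises arity and weight by the same amount, so the
  number of zeros is unchanged.\<close>

lemma heavy_collision_par_op_left:
  assumes "heavy_collision m p f"
  shows "heavy_collision m (p + q) (par_op p q f g)"
proof -
  obtain x y where "x \<in> bvec p" "y \<in> bvec p" "x \<noteq> y" "f x = f y"
    "p \<le> weight x + m" "p \<le> weight y + m"
    using assms unfolding heavy_collision_def by blast
  then show ?thesis
    unfolding heavy_collision_def
    by (intro bexI[of _ "x @ replicate q True"] bexI[of _ "y @ replicate q True"])
      (auto simp: par_op_def)
qed

lemma heavy_collision_par_op_right: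
  assumes "heavy_collision m q g"
  shows "heavy_collision m (p + q) (par_op p q f g)"
proof -
  obtain x y where "x \<in> bvec q" "y \<in> bvec q" "x \<noteq> y" "g x = g y"
    "q \<le> weight x + m" "q \<le> weight y + m"
    using assms unfolding heavy_collision_def by blast
  then show ?thesis
    unfolding heavy_collision_def
    by (intro bexI[of _ "replicate p True @ x"] bexI[of _ "replicate p True @ y"])
      (auto simp: par_op_def)
qed

lemma heavy_collision_compose_left:
  "heavy_collision m n f \<Longrightarrow> heavy_collision m n (compose (bvec n) g f)"
  unfolding heavy_collision_def by (metis compose_eq)

lemma heavy_collision_compose_right:
  assumes "heavy_collision m n g" "inj_on f (bvec n)" "f \<in> bvec n \<rightarrow> bvec n"
    and contr: "\<And>u. u \<in> bvec n \<Longrightarrow> weight (f u) \<le> weight u"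
  shows "heavy_collision m n (compose (bvec n) g f)"
proof -
  obtain x y where xy: "x \<in> bvec n" "y \<in> bvec n" "x \<noteq> y" "g x = g y"
    "n \<le> weight x + m" "n \<le> weight y + m"
    using assms unfolding heavy_collision_def by blast
  \<comment> \<open>An injective self-map of a finite set is surjective, so the collision of
    \<open>g\<close> has preimages under \<open>f\<close>.\<close>
  have "f ` bvec n = bvec n"
    using assms(2,3) by (intro endo_inj_surj finite_bvec) auto
  then obtain x' y' where x': "x' \<in> bvec n" "f x' = x" and y': "y' \<in> bvec n" "f y' = y"
    using xy(1,2) by (metis imageE)
  have "weight x \<le> weight x'" "weight y \<le> weight y'"
    using contr x' y' by auto
  then show ?thesis
    unfolding heavy_collision_def using xy x' y'
    by (intro bexI[of _ x'] bexI[of _ y']) (auto simp: compose_eq)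
qed

text \<open>Typing and contractivity are carried through the induction because the composition case
  needs both for the operator applied first.\<close>

lemma generated_inj_or_heavy_collision:
  assumes G: "G \<subseteq> contractive_increasing_ops" and arity: "\<And>n f. (n, f) \<in> G \<Longrightarrow> n \<le> m"
    and gen: "(n, f) \<in> generated G"
  shows "f \<in> bvec n \<rightarrow> bvec n \<and> (\<forall>u\<in>bvec n. weight (f u) \<le> weight u) \<and>
    (inj_on f (bvec n) \<or> heavy_collision m n f)"
  using gen
proof (induction n f rule: generated.induct[split_format (complete)])
  case (cell n f)
  then have "f \<in> bvec n \<rightarrow>\<^sub>E bvec n" "\<forall>u\<in>bvec n. weight (f u) \<le> weight u"
    using G by (auto simp: contractive_increasing_ops_def bool_ops_def contractive_def)
  then show ?case
    using heavy_collision_cell[OF arity[OF cell]] by (auto simp: PiE_iff)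
next
  case (ident n)
  then show ?case
    by (auto simp: id_op_def inj_on_def)
next
  case (seq n f g)
  have maps: "f u \<in> bvec n" if "u \<in> bvec n" for u
    using seq.IH(1) that by auto
  have "compose (bvec n) g f \<in> bvec n \<rightarrow> bvec n"
    using seq.IH by (auto simp: compose_def Pi_iff)
  moreover have "weight (compose (bvec n) g f u) \<le> weight u" if "u \<in> bvec n" for u
    using seq.IH maps[OF that] that by (metis compose_eq order_trans)
  moreover have "inj_on (compose (bvec n) g f) (bvec n)"
    if "inj_on f (bvec n)" "inj_on g (bvec n)"
    using that maps by (intro inj_onI) (metis compose_eq inj_onD)
  \<comment> \<open>If \<open>f\<close> has a heavy collision, it survives any \<open>g\<close>; if
    \<open>f\<close> is injective, a heavy collision of \<open>g\<close> is pulled back along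
    \<open>f\<close>.\<close>
  ultimately show ?case
    using seq.IH heavy_collision_compose_left heavy_collision_compose_right by blast
next
  case (par p f q g)
  have "par_op p q f g \<in> bvec (p + q) \<rightarrow> bvec (p + q)"
    using par.IH by (auto simp: par_op_def Pi_iff)
  moreover have "weight (par_op p q f g u) \<le> weight u" if "u \<in> bvec (p + q)" for u
  proof -
    have "weight (f (take p u)) \<le> weight (take p u)" "weight (g (drop p u)) \<le> weight (drop p u)"
      using par.IH that by auto
    then have "weight (par_op p q f g u) \<le> weight (take p u @ drop p u)"
      using that unfolding weight_append by (simp add: par_op_def)
    then show ?thesis
      by simp
  qed
  ultimately show ?case
    using par.IH inj_on_par_op heavy_collision_par_op_left heavy_collision_par_op_right by blast
qed

text \<open>The threshold 2 is chosen for arity \<open>m + 2\<close>: the vectors with at most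
  \<open>m\<close> zeros are then exactly those left alone, while weights 0 and 1 still provide
  distinct vectors to identify.\<close>

definition kill_light :: "nat \<Rightarrow> bool list \<Rightarrow> bool list" where
  "kill_light n = (\<lambda>v\<in>bvec n. if weight v < 2 then replicate n False else v)"

lemma kill_light_contractive_increasing: "(n, kill_light n) \<in> contractive_increasing_ops"
proof -
  have "kill_light n \<in> bvec n \<rightarrow>\<^sub>E bvec n"
    by (auto simp: kill_light_def)
  moreover have "weight (kill_light n u) \<le> weight u" if "u \<in> bvec n" for u
    using that by (simp add: kill_light_def)
  \<comment> \<open>If \<open>u\<close> is killed, its image is the least vector; otherwise
    \<open>v\<close> has weight at least 2 as well, and both are fixed.\<close>
  moreover have "bvec_le (kill_light n u) (kill_light n v)"
    if "u \<in> bvec n" "v \<in> bvec n" "bvec_le u v" for u v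
    using that weight_mono[OF that(3)] by (auto simp: kill_light_def bvec_le_zero)
  ultimately show ?thesis
    by (simp add: contractive_increasing_ops_def bool_ops_def increasing_def contractive_def)
qed

lemma kill_light_not_inj: "\<not> inj_on (kill_light (m + 2)) (bvec (m + 2))"
proof
  let ?u = "True # replicate (m + 1) False" and ?v = "replicate (m + 2) False"
  assume "inj_on (kill_light (m + 2)) (bvec (m + 2))"
  moreover have "weight ?u = 1"
    using weight_replicate_False[of "m + 1"] by (simp add: weight_def)
  then have "kill_light (m + 2) ?u = kill_light (m + 2) ?v"
    using weight_replicate_False[of "m + 2"] by (simp add: kill_light_def)
  ultimately have "?u = ?v"
    by (rule inj_onD) simp_all
  then show False
    by simp
qed

lemma kill_light_no_heavy_collision: "\<not> heavy_collision m (m + 2) (kill_light (m + 2))"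
  by (auto simp: heavy_collision_def kill_light_def)

theorem proposition4:
  "\<not> (\<exists>G. finite G \<and> G \<subseteq> contractive_increasing_ops \<and>
        (\<forall>n f. (n, f) \<in> contractive_increasing_ops \<longrightarrow> (n, f) \<in> generated G))"
proof
  assume "\<exists>G. finite G \<and> G \<subseteq> contractive_increasing_ops \<and>
        (\<forall>n f. (n, f) \<in> contractive_increasing_ops \<longrightarrow> (n, f) \<in> generated G)"
  then obtain G where fin: "finite G" and G: "G \<subseteq> contractive_increasing_ops"
    and gen: "\<And>n f. (n, f) \<in> contractive_increasing_ops \<Longrightarrow> (n, f) \<in> generated G"
    by blast
  \<comment> \<open>The first components are the arities of the cells, finitely many and hence
    bounded.\<close>
  obtain m where "\<forall>k\<in>fst ` G. k \<le> m"
    using fin by (meson finite_imageI finite_nat_set_iff_bounded_le)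
  then have "n \<le> m" if "(n, f) \<in> G" for n f
    using that by force
  then have "inj_on (kill_light (m + 2)) (bvec (m + 2)) \<or>
      heavy_collision m (m + 2) (kill_light (m + 2))"
    using generated_inj_or_heavy_collision[OF G] gen[OF kill_light_contractive_increasing] by blast
  then show False
    using kill_light_not_inj kill_light_no_heavy_collision by blast
qed

end
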